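(* Let $F_2$ and $F_3$ be finite subsets of $\mathbb{Z}^2$ with the same line sums (the same row sum in every row and the same column sum in every column). Let $F_1$ be a uniquely determined neighbour of $F_2$ and $F_3$, and put $\alpha = \alpha(F_2, F_1)$. If $F_2$ and $F_3$ are disjoint, then $$|F_2| \leq 8\alpha^2.$$
   Context: For $F$ a finite subset of $\mathbb{Z}^2$, the row sum of row $i\in\mathbb{Z}$ is the number of $j \in \mathbb{Z}$ with $(i,j)\in F$, and the column sum of column $j\in\mathbb{Z}$ is the number of $i \in \mathbb{Z}$ with $(i,j)\in F$. The row and column sums together are called the line sums of $F$. A finite set $F\subset\mathbb{Z}^2$ is called uniquely determined (by its line sums) if every subset $F'$ of $\mathbb{Z}^2$ with exactly the same row and column sums as $F$ equals $F$. For finite $F, G\subset \mathbb{Z}^2$ with row sums $r_i^{F}, r_i^{G}$ ($i\in\mathbb{Z}$) and column sums $c_j^{F}, c_j^{G}$ ($j\in\mathbb{Z}$), define $$\alpha(F,G)=\frac12\Big(\sum_{j\in\mathbb{Z}}|c_j^{F}-c_j^{G}|+\sum_{i\in\mathbb{Z}}|r_i^{F}-r_i^{G}|\Big).$$ Uniquely determined neighbour: let $G$ be a finite subset of $\mathbb{Z}^2$ with column sums $c_j$, and let $C$ be a finite set of $n$ column indices containing every column with non-zero column sum of $G$. A set $F_1$ is a uniquely determined neighbour of $G$ if $F_1$ is a finite uniquely determined set, $F_1$ has the same row sum as $G$ in every row, all columns of $F_1$ with index outside $C$ are empty, and there is an enumeration $\sigma(1),\ldots,\sigma(n)$ of $C$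 with $c_{\sigma(1)}\ge c_{\sigma(2)}\ge\ldots\ge c_{\sigma(n)}$ such that the column sums $v_j$ of $F_1$ satisfy $v_{\sigma(1)}\ge v_{\sigma(2)}\ge\ldots\ge v_{\sigma(n)}$. (This depends only on the line sums of $G$ and not on the choice of $C$.) *)

theory Defs
  imports Complex_Main "HOL-Library.Groups_Big_Fun"
begin

definition row_sum :: "(int \<times> int) set \<Rightarrow> int \<Rightarrow> nat" where
  "row_sum F i = card {j. (i, j) \<in> F}"

definition col_sum :: "(int \<times> int) set \<Rightarrow> int \<Rightarrow> nat" where
  "col_sum F j = card {i. (i, j) \<in> F}"

definition same_line_sums :: "(int \<times> int) set \<Rightarrow> (int \<times> int) set \<Rightarrow> bool" where
  "same_line_sums F G \<longleftrightarrow>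
     (\<forall>i. row_sum F i = row_sum G i) \<and> (\<forall>j. col_sum F j = col_sum G j)"

(* A subset of the lattice whose true line sums equal those of a finite set is itself finite, so
   restricting F' to finite sets loses nothing.  The restriction has to be explicit because card
   is 0 on infinite sets: without it, UNIV would have the same line sums as {}. *)
definition uniquely_determined :: "(int \<times> int) set \<Rightarrow> bool" where
  "uniquely_determined F \<longleftrightarrow>
     finite F \<and> (\<forall>F'. finite F' \<and> same_line_sums F' F \<longrightarrow> F' = F)"

(* Sum_any adds up the nonzero values; for finite F and G there are finitely many of them. *)
definition alpha :: "(int \<times> int) set \<Rightarrow> (int \<times> int) set \<Rightarrow> real" where
  "alpha F G = 1 / 2 *
     (Sum_any (\<lambda>j. \<bar>real (col_sum F j) - real (col_sum G j)\<bar>) +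
      Sum_any (\<lambda>i. \<bar>real (row_sum F i) - real (row_sum G i)\<bar>))"

(* The notion does not depend on C, so C is quantified existentially. *)
definition ud_neighbour :: "(int \<times> int) set \<Rightarrow> (int \<times> int) set \<Rightarrow> bool" where
  "ud_neighbour F\<^sub>1 G \<longleftrightarrow>
     finite G \<and> uniquely_determined F\<^sub>1 \<and> (\<forall>i. row_sum F\<^sub>1 i = row_sum G i) \<and>
     (\<exists>C n \<sigma>. finite C \<and> card C = n \<and> {j. col_sum G j \<noteq> 0} \<subseteq> C \<and>
        (\<forall>j. j \<notin> C \<longrightarrow> col_sum F\<^sub>1 j = 0) \<and>
        bij_betw \<sigma> {1..n} C \<and>
        antimono_on {1..n} (\<lambda>k. col_sum G (\<sigma> k)) \<and>
        antimono_on {1..n} (\<lambda>k. col_sum F\<^sub>1 (\<sigma> k)))"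

end

(* A uniquely determined set F has columns that are nested by inclusion.  Let h j be the number of
   distinct nonzero column sums of F that are at most the sum of column j, and let f i be the
   number of those that are smaller than the sum of every column meeting row i.  The weight
   f i - h j is at most -1 on F and nonnegative off F, so for a set G with the same row sums,
   summing it over G and over F gives |F - G| <= sum_j (v_j - c_j) h_j, where v and c are the
   column sums of F and G.  As 0 <= h <= s, with s the number of distinct nonzero column sums,
   and sum_j v_j = sum_j c_j, the right-hand side is at most alpha s.  Moreover s^2 <= 2|F|, since
   s distinct positive column sums add up to at least s(s+1)/2.  If F2 and F3 are disjoint, then
   F1 is the union of F1 - F2 and F1 - F3, whence |F1| <= 2 alpha s and |F1|^2 <= 8 alpha^2 |F1|. *)

theory Submission
  imports Defs
begin

section \<open>Counting points through line sums\<close>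

lemma sum_fst_row_sum:
  fixes f :: "int \<Rightarrow> real"
  assumes "finite F" "finite A" "fst ` F \<subseteq> A"
  shows "(\<Sum>p\<in>F. f (fst p)) = (\<Sum>i\<in>A. real (row_sum F i) * f i)"
proof -
  have fin: "finite {j. (i, j) \<in> F}" for i
    by (rule finite_subset[of _ "snd ` F"]) (use assms in force)+
  have "F = Sigma A (\<lambda>i. {j. (i, j) \<in> F})"
    using assms(3) by force
  then have "(\<Sum>p\<in>F. f (fst p)) = (\<Sum>p\<in>Sigma A (\<lambda>i. {j. (i, j) \<in> F}). f (fst p))"
    by simp
  also have "\<dots> = (\<Sum>i\<in>A. \<Sum>j\<in>{j. (i, j) \<in> F}. f i)"
    using assms(2) fin by (subst sum.Sigma) (auto simp: case_prod_unfold)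
  finally show ?thesis
    by (simp add: row_sum_def)
qed

lemma row_sum_converse: "row_sum (F\<inverse>) = col_sum F"
  by (simp add: fun_eq_iff row_sum_def col_sum_def)

text \<open>The row version applied to the transpose. Together they show that the total of a weight
  \<open>f i - h j\<close> over a finite set depends only on its line sums.\<close>

lemma sum_snd_col_sum:
  fixes g :: "int \<Rightarrow> real"
  assumes "finite F" "finite B" "snd ` F \<subseteq> B"
  shows "(\<Sum>p\<in>F. g (snd p)) = (\<Sum>j\<in>B. real (col_sum F j) * g j)"
proof -
  have "(\<Sum>p\<in>F. g (snd p)) = (\<Sum>p\<in>F\<inverse>. g (fst p))"
    by (rule sum.reindex_bij_witness[of _ prod.swap prod.swap]) auto
  also have "\<dots> = (\<Sum>j\<in>B. real (row_sum (F\<inverse>) j) * g j)"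
    using assms by (intro sum_fst_row_sum) force+
  finally show ?thesis
    by (simp add: row_sum_converse)
qed

lemma card_eq_sum_col_sum:
  assumes "finite F" "finite B" "snd ` F \<subseteq> B"
  shows "card F = (\<Sum>j\<in>B. col_sum F j)"
proof -
  have "real (card F) = real (\<Sum>j\<in>B. col_sum F j)"
    using sum_snd_col_sum[OF assms, of "\<lambda>_. 1"] by simp
  then show ?thesis by linarith
qed

lemma card_eq_sum_row_sum:
  assumes "finite F" "finite A" "fst ` F \<subseteq> A"
  shows "card F = (\<Sum>i\<in>A. row_sum F i)"
proof -
  have "real (card F) = real (\<Sum>i\<in>A. row_sum F i)"
    using sum_fst_row_sum[OF assms, of "\<lambda>_. 1"] by simp
  then show ?thesis by linarith
qed

lemma card_eq_if_row_sum_eq: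
  assumes "finite F" "finite G" "\<And>i. row_sum F i = row_sum G i"
  shows "card F = card G"
  using assms card_eq_sum_row_sum[of F "fst ` F \<union> fst ` G"]
    card_eq_sum_row_sum[of G "fst ` F \<union> fst ` G"] by simp

lemma col_sum_pos:
  assumes "finite F" "(i, j) \<in> F"
  shows "0 < col_sum F j"
proof -
  have "finite {i. (i, j) \<in> F}"
    by (rule finite_subset[of _ "fst ` F"]) (use assms in force)+
  then show ?thesis
    using assms(2) by (auto simp: col_sum_def card_gt_0_iff)
qed

section \<open>Rectangle switches and nested columns\<close>

lemma card_exchange:
  assumes "finite A" "x \<in> A" "y \<notin> A"
  shows "card (insert y (A - {x})) = card A"
proof -
  have "card A > 0"
    using assms card_gt_0_iff by blast
  then show ?thesis
    using assms by simp
qed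

text \<open>Otherwise the corners of a rectangle could be switched.\<close>
lemma uniquely_determined_columns_nested:
  assumes ud: "uniquely_determined F"
  shows "{i. (i, j) \<in> F} \<subseteq> {i. (i, k) \<in> F} \<or> {i. (i, k) \<in> F} \<subseteq> {i. (i, j) \<in> F}"
proof (rule ccontr)
  assume "\<not> ?thesis"
  then obtain x y where xy: "(x, j) \<in> F" "(x, k) \<notin> F" "(y, k) \<in> F" "(y, j) \<notin> F"
    by auto
  then have ne: "x \<noteq> y" "j \<noteq> k"
    by auto
  have fin: "finite F"
    using ud by (simp add: uniquely_determined_def)
  \<comment> \<open>One diagonal of the rectangle on rows \<open>x\<close>, \<open>y\<close> and
    columns \<open>j\<close>, \<open>k\<close> is exchanged for the other, so each of these four
    lines loses one point and gains one.\<close>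
  define G where "G = insert (x, k) (insert (y, j) (F - {(x, j), (y, k)}))"
  have finr: "finite {b. (a, b) \<in> F}" for a
    by (rule finite_subset[of _ "snd ` F"]) (use fin in force)+
  have finc: "finite {a. (a, b) \<in> F}" for b
    by (rule finite_subset[of _ "fst ` F"]) (use fin in force)+
  have "row_sum G a = row_sum F a" for a
  proof -
    consider "a = x" | "a = y" | "a \<noteq> x" "a \<noteq> y" by blast
    then show ?thesis
    proof cases
      case 1
      have "{b. (a, b) \<in> G} = insert k ({b. (a, b) \<in> F} - {j})"
        using 1 ne xy by (auto simp: G_def)
      then show ?thesis
        using 1 xy finr by (simp add: row_sum_def card_exchange del: card_insert_disjoint)
    next
      case 2
      have "{b. (a, b) \<in> G} = insert j ({b. (a, b) \<in> F} - {k})"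
        using 2 ne xy by (auto simp: G_def)
      then show ?thesis
        using 2 xy finr by (simp add: row_sum_def card_exchange del: card_insert_disjoint)
    next
      case 3
      then show ?thesis by (simp add: row_sum_def G_def)
    qed
  qed
  moreover have "col_sum G b = col_sum F b" for b
  proof -
    consider "b = j" | "b = k" | "b \<noteq> j" "b \<noteq> k" by blast
    then show ?thesis
    proof cases
      case 1
      have "{a. (a, b) \<in> G} = insert y ({a. (a, b) \<in> F} - {x})"
        using 1 ne xy by (auto simp: G_def)
      then show ?thesis
        using 1 xy finc by (simp add: col_sum_def card_exchange del: card_insert_disjoint)
    next
      case 2
      have "{a. (a, b) \<in> G} = insert x ({a. (a, b) \<in> F} - {y})"
        using 2 ne xy by (auto simp: G_def)
      then show ?thesis
        using 2 xy finc by (simp add: col_sum_def card_exchange del: card_insert_disjoint)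
    next
      case 3
      then show ?thesis by (simp add: col_sum_def G_def)
    qed
  qed
  moreover have "finite G"
    using fin by (simp add: G_def)
  ultimately have "G = F"
    using ud by (simp add: uniquely_determined_def same_line_sums_def)
  then show False
    using xy by (auto simp: G_def)
qed

text \<open>Nestedness leaves two cases: column \<open>j\<close> lies inside column
  \<open>k\<close>, or the reverse inclusion holds and the cardinalities force equality.\<close>

lemma uniquely_determined_mem_mono:
  assumes "uniquely_determined F" "(i, j) \<in> F" "col_sum F j \<le> col_sum F k"
  shows "(i, k) \<in> F"
proof -
  have "finite F"
    using assms(1) by (simp add: uniquely_determined_def)
  then have "finite {a. (a, b) \<in> F}" for b
    by (rule finite_subset[rotated, OF finite_imageI[of _ fst]]) force
  then have "{i. (i, k) \<in> F} = {i. (i, j) \<in> F}" if "{i. (i, k) \<in> F} \<subseteq> {i. (i, j) \<in> F}"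
    using that assms(3) by (intro card_seteq) (auto simp: col_sum_def)
  then show ?thesis
    using uniquely_determined_columns_nested[OF assms(1), of j k] assms(2) by blast
qed

section \<open>The number of distinct column sums\<close>

lemma card_squared_le_sum:
  fixes T :: "nat set"
  assumes "finite T" "0 \<notin> T"
  shows "(card T)\<^sup>2 \<le> 2 * \<Sum>T"
  using assms
proof (induction T rule: finite_linorder_max_induct)
  case empty
  then show ?case by simp
next
  case (insert b A)
  \<comment> \<open>As \<open>b\<close> exceeds all of \<open>A\<close>, this gives |A| \<le> b - 1,
    so adding \<open>b\<close> raises the square by 2|A| + 1 \<le> 2b.\<close>
  have "A \<subseteq> {1..<b}"
    using insert.hyps insert.prems by (auto simp: Suc_le_eq intro!: gr0I)
  then have "card A \<le> b - 1"
    using card_mono[of "{1..<b}" A] by simp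
  moreover have "b \<noteq> 0" "b \<notin> A"
    using insert by auto
  ultimately show ?case
    using insert by (simp add: power2_eq_square)
qed

text \<open>Only occupied columns are used, which keeps the value 0 out.\<close>

definition col_sums :: "(int \<times> int) set \<Rightarrow> nat set" where
  "col_sums F = col_sum F ` snd ` F"

lemma finite_col_sums: "finite F \<Longrightarrow> finite (col_sums F)"
  by (simp add: col_sums_def)

lemma card_col_sums_squared_le:
  assumes "finite F"
  shows "(card (col_sums F))\<^sup>2 \<le> 2 * card F"
proof -
  have "0 \<notin> col_sums F"
    using col_sum_pos[OF assms] by (force simp: col_sums_def)
  then have "(card (col_sums F))\<^sup>2 \<le> 2 * \<Sum>(col_sums F)"
    using assms by (intro card_squared_le_sum finite_col_sums)
  \<comment> \<open>A value shared by several columns counts once on the left and once per column on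
    the right.\<close>
  also have "\<Sum>(col_sums F) \<le> (\<Sum>j\<in>snd ` F. col_sum F j)"
    unfolding col_sums_def using assms sum_image_le[of "snd ` F" "\<lambda>x. x" "col_sum F"] by simp
  also have "\<dots> = card F"
    using assms by (intro card_eq_sum_col_sum[symmetric]) auto
  finally show ?thesis by simp
qed

section \<open>The weight argument\<close>

lemma alpha_same_row_sums:
  assumes "\<And>i. row_sum F i = row_sum G i"
    and "finite B" "snd ` F \<subseteq> B" "snd ` G \<subseteq> B"
  shows "alpha F G = 1 / 2 * (\<Sum>j\<in>B. \<bar>real (col_sum F j) - real (col_sum G j)\<bar>)"
proof -
  \<comment> \<open>Columns outside \<open>B\<close> are empty, so the sum over all integers reduces
    to \<open>B\<close>.\<close>
  have "col_sum H j = 0" if "j \<notin> B" "snd ` H \<subseteq> B" for H j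
  proof -
    have "{i. (i, j) \<in> H} = {}"
      using that by force
    then show ?thesis
      by (simp add: col_sum_def)
  qed
  then have "{j. \<bar>real (col_sum F j) - real (col_sum G j)\<bar> \<noteq> 0} \<subseteq> B"
    using assms by (force simp: subset_iff)
  then show ?thesis
    using assms by (simp add: alpha_def Sum_any.expand_superset)
qed

lemma card_diff_le_alpha:
  assumes ud: "uniquely_determined F" and "finite G"
    and rows: "\<And>i. row_sum G i = row_sum F i"
  shows "real (card (F - G)) \<le> alpha G F * real (card (col_sums F))"
proof -
  have fin: "finite F"
    using ud by (simp add: uniquely_determined_def)
  define T where "T = col_sums F"
  have finT: "finite T"
    using fin by (simp add: T_def finite_col_sums)
  \<comment> \<open>For an empty row the condition is vacuous and \<open>f i\<close> takes its
    maximal value \<open>card T\<close>.\<close>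
  define f where "f i = real (card {t\<in>T. \<forall>j. (i, j) \<in> F \<longrightarrow> t < col_sum F j})" for i
  define h where "h j = real (card {t\<in>T. t \<le> col_sum F j})" for j
  define w where "w p = f (fst p) - h (snd p)" for p
  have w_in: "w p \<le> -1" if "p \<in> F" for p
  proof -
    obtain i j where p: "p = (i, j)" by force
    have "col_sum F j \<in> T"
      using that p by (force simp: T_def col_sums_def)
    \<comment> \<open>The inclusion is strict because t = \<open>col_sum F j\<close> lies only in
      the right-hand set.\<close>
    then have "{t\<in>T. \<forall>j. (i, j) \<in> F \<longrightarrow> t < col_sum F j} \<subset> {t\<in>T. t \<le> col_sum F j}"
      using that p by force
    then have "card {t\<in>T. \<forall>j. (i, j) \<in> F \<longrightarrow> t < col_sum F j} < card {t\<in>T. t \<le> col_sum F j}"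
      using finT by (intro psubset_card_mono) auto
    then show ?thesis
      by (simp add: w_def f_def h_def p)
  qed
  have w_out: "0 \<le> w p" if "p \<notin> F" for p
  proof -
    obtain i j where p: "p = (i, j)" by force
    \<comment> \<open>Otherwise column \<open>j\<close> would contain column \<open>k\<close>, and
      (i, j) would be in \<open>F\<close>.\<close>
    have "col_sum F j < col_sum F k" if "(i, k) \<in> F" for k
      using uniquely_determined_mem_mono[OF ud that, of j] \<open>p \<notin> F\<close> p by force
    then have "{t\<in>T. t \<le> col_sum F j} \<subseteq> {t\<in>T. \<forall>j. (i, j) \<in> F \<longrightarrow> t < col_sum F j}"
      by force
    then have "card {t\<in>T. t \<le> col_sum F j} \<le> card {t\<in>T. \<forall>j. (i, j) \<in> F \<longrightarrow> t < col_sum F j}"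
      using finT by (intro card_mono) auto
    then show ?thesis
      by (simp add: w_def f_def h_def p)
  qed
  define A where "A = fst ` F \<union> fst ` G"
  define B where "B = snd ` F \<union> snd ` G"
  have AB: "finite A" "finite B" "fst ` F \<subseteq> A" "fst ` G \<subseteq> A" "snd ` F \<subseteq> B" "snd ` G \<subseteq> B"
    using fin \<open>finite G\<close> by (auto simp: A_def B_def)
  have sum_w: "sum w H = (\<Sum>i\<in>A. real (row_sum H i) * f i) - (\<Sum>j\<in>B. real (col_sum H j) * h j)"
    if "finite H" "fst ` H \<subseteq> A" "snd ` H \<subseteq> B" for H
    using that AB by (simp add: w_def sum_subtractf sum_fst_row_sum[of H A] sum_snd_col_sum[of H B])
  define d where "d j = real (col_sum F j) - real (col_sum G j)" for j
  define s where "s = real (card T)"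
  have "card F = card G"
    using fin \<open>finite G\<close> rows by (intro card_eq_if_row_sum_eq) auto
  then have "real (\<Sum>j\<in>B. col_sum F j) = real (\<Sum>j\<in>B. col_sum G j)"
    using AB fin \<open>finite G\<close> by (simp add: card_eq_sum_col_sum[of _ B])
  then have d0: "(\<Sum>j\<in>B. d j) = 0"
    by (simp add: d_def sum_subtractf)
  have "real (card (F - G)) = (\<Sum>p\<in>F - G. 1)"
    by simp
  also have "\<dots> \<le> (\<Sum>p\<in>F - G. - w p)"
    using w_in by (intro sum_mono) force
  also have "\<dots> \<le> sum w (G - F) - sum w (F - G)"
    using w_out sum_nonneg[of "G - F" w] by (simp add: sum_negf)
  \<comment> \<open>The points of \<open>F \<inter> G\<close> cancel.\<close>
  also have "\<dots> = sum w G - sum w F"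
    using fin \<open>finite G\<close> sum.Int_Diff[of G w F] sum.Int_Diff[of F w G] by (simp add: Int_commute)
  \<comment> \<open>Equal row sums make the \<open>f\<close> parts cancel.\<close>
  also have "\<dots> = (\<Sum>j\<in>B. d j * h j)"
    using AB fin \<open>finite G\<close> rows by (simp add: sum_w d_def left_diff_distrib sum_subtractf)
  \<comment> \<open>Since \<open>d\<close> sums to 0, \<open>h\<close> may be shifted by a constant.
    The midpoint of [0, s] bounds the shifted values by s/2, and this 1/2 is the factor in
    \<open>alpha\<close>.\<close>
  also have "\<dots> = (\<Sum>j\<in>B. d j * (h j - s / 2))"
    using d0 by (simp add: right_diff_distrib sum_subtractf flip: sum_distrib_right sum_divide_distrib)
  also have "\<dots> \<le> (\<Sum>j\<in>B. \<bar>d j\<bar> * (s / 2))"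
  proof (rule sum_mono)
    fix j
    have "0 \<le> h j" "h j \<le> s"
      using finT by (auto simp: h_def s_def intro!: card_mono)
    then have "\<bar>h j - s / 2\<bar> \<le> s / 2"
      by linarith
    then have "\<bar>d j * (h j - s / 2)\<bar> \<le> \<bar>d j\<bar> * (s / 2)"
      by (simp only: abs_mult mult_left_mono abs_ge_zero)
    then show "d j * (h j - s / 2) \<le> \<bar>d j\<bar> * (s / 2)"
      by linarith
  qed
  also have "\<dots> = alpha G F * s"
    using AB fin \<open>finite G\<close> rows
    by (simp add: alpha_same_row_sums[of G F B] d_def abs_minus_commute flip: sum_distrib_right sum_divide_distrib)
  finally show ?thesis
    by (simp add: s_def T_def)
qed

theorem corollary1:
  fixes F\<^sub>1 F\<^sub>2 F\<^sub>3 :: "(int \<times> int) set" and \<alpha> :: real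
  assumes "finite F\<^sub>2" and "finite F\<^sub>3"
    and "same_line_sums F\<^sub>2 F\<^sub>3"
    and "ud_neighbour F\<^sub>1 F\<^sub>2" and "ud_neighbour F\<^sub>1 F\<^sub>3"
    and "\<alpha> = alpha F\<^sub>2 F\<^sub>1"
    and "F\<^sub>2 \<inter> F\<^sub>3 = {}"
  shows "real (card F\<^sub>2) \<le> 8 * \<alpha>\<^sup>2"
proof -
  define s where "s = real (card (col_sums F\<^sub>1))"
  have ud: "uniquely_determined F\<^sub>1"
    and rows2: "\<And>i. row_sum F\<^sub>2 i = row_sum F\<^sub>1 i"
    and rows3: "\<And>i. row_sum F\<^sub>3 i = row_sum F\<^sub>1 i"
    using assms(4,5) by (simp_all add: ud_neighbour_def)
  then have fin: "finite F\<^sub>1"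
    by (simp add: uniquely_determined_def)
  have card: "card F\<^sub>2 = card F\<^sub>1"
    using assms(1) fin rows2 by (rule card_eq_if_row_sum_eq)
  \<comment> \<open>\<open>alpha\<close> sees only line sums, so one value serves both sets.\<close>
  have \<alpha>3: "alpha F\<^sub>3 F\<^sub>1 = \<alpha>"
    using assms(3,6) by (simp add: alpha_def same_line_sums_def)
  have "F\<^sub>1 = (F\<^sub>1 - F\<^sub>2) \<union> (F\<^sub>1 - F\<^sub>3)"
    using assms(7) by blast
  then have "real (card F\<^sub>1) \<le> real (card (F\<^sub>1 - F\<^sub>2)) + real (card (F\<^sub>1 - F\<^sub>3))"
    using card_Un_le[of "F\<^sub>1 - F\<^sub>2" "F\<^sub>1 - F\<^sub>3"] by simp
  also have "\<dots> \<le> \<alpha> * s + \<alpha> * s"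
    using card_diff_le_alpha[OF ud assms(1) rows2] card_diff_le_alpha[OF ud assms(2) rows3]
    by (simp add: \<alpha>3 s_def flip: assms(6))
  finally have "(real (card F\<^sub>1))\<^sup>2 \<le> (2 * \<alpha> * s)\<^sup>2"
    by (intro power_mono) auto
  also have "\<dots> = 4 * \<alpha>\<^sup>2 * s\<^sup>2"
    by (simp add: power_mult_distrib)
  also have "s\<^sup>2 \<le> 2 * real (card F\<^sub>1)"
    unfolding s_def using of_nat_mono[OF card_col_sums_squared_le[OF fin], where 'a = real] by simp
  finally have "real (card F\<^sub>1) * real (card F\<^sub>1) \<le> 8 * \<alpha>\<^sup>2 * real (card F\<^sub>1)"
    by (simp add: power2_eq_square mult_left_mono)
  \<comment> \<open>One factor |F1| is cancelled; if it is 0, the bound is trivial.\<close>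
  then show ?thesis
    unfolding card by (cases "card F\<^sub>1 = 0") auto
qed

end
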